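(* Let $X, V, S, \mathcal{H}_*$, the symmetrization $*$, the polarization map $(u,H)\mapsto u^H$ and the map $\Theta$ be as in the abstract symmetrization framework described in the context. Let $f:X\to\mathbb{R}\cup\{+\infty\}$ be a proper, lower semi-continuous functional, bounded from below, such that $$f(u^H)\leq f(u)\qquad\text{for all } u\in S \text{ and } H\in\mathcal{H}_*,$$ and assume that for all $u\in X$ there exists $\xi\in S$ with $f(\xi)\leq f(u)$. Put $\mathcal{M}:=\inf_X f$. Then there exists a constant $C>0$ such that, for any $\varepsilon>0$, there exists $v\in X$ such that (a) $\|v-v^*\|_V\leq C\varepsilon$; (b) $f(v)<\mathcal{M}+\varepsilon^2$; (c) $|df|(v)\leq\varepsilon$, where $|df|$ denotes the weak slope of $f$. In particular, $f$ has a symmetric Palais-Smale sequence at level $\mathcal{M}$ (a $(SPS)_{\mathcal{M}}$-sequence). If $f$ satisfies the symmetric Palais-Smale condition $(SPS)_{\mathcal{M}}$, then $f$ admits a critical point $z\in X$ for the weak slope (i.e. $|df|(z)=0$) with $f(z)=\mathcal{M}$ and $z=z^*$.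
   Context: Abstract symmetrization framework. $X$ and $V$ are Banach spaces with norms $\|\cdot\|$ (on $X$) and $\|\cdot\|_V$ (on $V$), $S\subseteq X$ is a subset, and $\mathcal{H}_*$ is a path-connected topological space. There are two maps: $*:S\to S$, $u\mapsto u^*$ (symmetrization), and $h:S\times\mathcal{H}_*\to S$, $(u,H)\mapsto u^H$ (polarization). Iterated polarizations are written $u^{H_1H_2\cdots H_m}:=(\cdots((u^{H_1})^{H_2})\cdots)^{H_m}$. It is assumed that: (1) $X$ is continuously embedded in $V$ (so elements of $X$ are regarded as elements of $V$); (2) $h$ is continuous ($S$ carrying the topology induced by $X$); (3) for each $u\in S$ and $H\in\mathcal{H}_*$, $(u^* )^H=(u^H)^*=u^*$ and $u^{HH}=u^H$; (4) there exists a sequence $(H_m)\subset\mathcal{H}_*$ such that, for every $u\in S$, $u^{H_1\cdots H_m}$ converges to $u^*$ in $V$ as $m\to\infty$; (5) for every $u,v\in S$ and $H\in\mathcal{H}_*$, $\|u^H-v^H\|_V\leq\|u-v\|_V$. Moreover there is a map $\Theta:(X,\|\cdot\|_V)\to(S,\|\cdot\|_V)$ that is Lipschitz with constant $C_\Theta>0$ and satisfies $\Theta|_S=\mathrm{Id}|_S$; the symmetrization is extended to a map $*:X\to V$ by $u^*:=(\Theta(u))^*$ for every $u\in X$. A functional $f:X\to\mathbb{R}\cup\{+\infty\}$ is proper if it is not identically $+\infty$. Weak slope (Degiovanni-Marzocchi). If $(Y,d)$ is a metric space, $g:Y\to\mathbb{R}$ is continuous and $y\in Y$, then $|dg|(y)\in[0,+\infty]$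 is the supremum of the $\sigma\geq 0$ for which there exist $\delta>0$ and a continuous map $\mathscr{H}:B(y,\delta)\times[0,\delta]\to Y$ ($B(y,\delta)$ being the open ball) with $d(\mathscr{H}(\eta,t),\eta)\leq t$ and $g(\mathscr{H}(\eta,t))\leq g(\eta)-\sigma t$ for all $(\eta,t)\in B(y,\delta)\times[0,\delta]$. If $f:X\to\mathbb{R}\cup\{+\infty\}$ is lower semi-continuous, let $\mathrm{epi}(f)=\{(u,\lambda)\in X\times\mathbb{R}: f(u)\leq\lambda\}$ with the metric $d((u,\lambda),(v,\mu))=(\|u-v\|^2+(\lambda-\mu)^2)^{1/2}$, and let $G_f:\mathrm{epi}(f)\to\mathbb{R}$, $G_f(u,\lambda)=\lambda$, which is continuous (indeed $1$-Lipschitz, so $|dG_f|\leq 1$). For $u\in X$ with $f(u)<+\infty$, the weak slope of $f$ at $u$ is $$|df|(u)=\frac{|dG_f|(u,f(u))}{\sqrt{1-|dG_f|(u,f(u))^2}}\ \text{ if } |dG_f|(u,f(u))<1,\qquad |df|(u)=+\infty\ \text{ if } |dG_f|(u,f(u))=1.$$ (This is consistent with the previous definition when $f$ is real-valued and continuous, and $|df|(u)=\|df(u)\|_{X'}$ if $f$ is $C^1$.) Symmetric Palais-Smale notions. For $c\in\mathbb{R}$, a sequence $(u_j)\subset X$ is a symmetric Palais-Smale sequence at level $c$ ($(SPS)_c$-sequence) if $|df|(u_j)\to 0$, $f(u_j)\to c$ and $\|u_j-u_j^*\|_V\to 0$ as $j\to\infty$. The functional $f$ satisfies the symmetric Palais-Smale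 condition at level $c$, $(SPS)_c$, if any $(SPS)_c$-sequence has a subsequence converging in $X$. *)

theory Defs
  imports "HOL-Analysis.Analysis"
begin

section \<open>Abstract symmetrization framework\<close>

definition iter_pol :: "('x \<Rightarrow> 'h \<Rightarrow> 'x) \<Rightarrow> 'x \<Rightarrow> 'h list \<Rightarrow> 'x" where
  "iter_pol pol u Hs = foldl pol u Hs"

text \<open>
  The embedding of \<open>X\<close> into \<open>V\<close> is an explicit injective bounded linear map \<open>\<iota>\<close>, so the
  \<open>V\<close>-norm of \<open>u \<in> X\<close> reads \<open>norm (\<iota> u)\<close>. The space of polarizers is a subspace \<open>HH\<close> of a
  topological space. The maps \<open>star\<close> and \<open>pol\<close> are meaningful only on \<open>S\<close> and on
  \<open>S \<times> HH\<close>; their values elsewhere are unconstrained.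
\<close>

locale symmetrization_framework =
  fixes \<iota> :: "'x::banach \<Rightarrow> 'v::banach"
    and S :: "'x set"
    and HH :: "'h::topological_space set"
    and star :: "'x \<Rightarrow> 'x"
    and pol :: "'x \<Rightarrow> 'h \<Rightarrow> 'x"
    and \<Theta> :: "'x \<Rightarrow> 'x"
  assumes HH_path_connected: "path_connected HH"
    and star_maps: "\<And>u. u \<in> S \<Longrightarrow> star u \<in> S"
    and pol_maps: "\<And>u H. u \<in> S \<Longrightarrow> H \<in> HH \<Longrightarrow> pol u H \<in> S"
    and embedding_bounded_linear: "bounded_linear \<iota>"
    and embedding_inj: "inj \<iota>"
    and pol_continuous: "continuous_on (S \<times> HH) (\<lambda>(u, H). pol u H)"
    and pol_star: "\<And>u H. u \<in> S \<Longrightarrow> H \<in> HH \<Longrightarrow> pol (star u) H = star u"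
    and star_pol: "\<And>u H. u \<in> S \<Longrightarrow> H \<in> HH \<Longrightarrow> star (pol u H) = star u"
    and pol_idem: "\<And>u H. u \<in> S \<Longrightarrow> H \<in> HH \<Longrightarrow> pol (pol u H) H = pol u H"
    and approximation:
      "\<exists>H :: nat \<Rightarrow> 'h. range H \<subseteq> HH \<and>
         (\<forall>u\<in>S. (\<lambda>m. \<iota> (iter_pol pol u (map H [1..<Suc m]))) \<longlonglongrightarrow> \<iota> (star u))"
    and pol_contraction:
      "\<And>u v H. u \<in> S \<Longrightarrow> v \<in> S \<Longrightarrow> H \<in> HH \<Longrightarrow>
         norm (\<iota> (pol u H) - \<iota> (pol v H)) \<le> norm (\<iota> u - \<iota> v)"
    and Theta_maps: "\<And>u. \<Theta> u \<in> S"
    and Theta_Lipschitz: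
      "\<exists>C>0. \<forall>u v. norm (\<iota> (\<Theta> u) - \<iota> (\<Theta> v)) \<le> C * norm (\<iota> u - \<iota> v)"
    and Theta_id: "\<And>u. u \<in> S \<Longrightarrow> \<Theta> u = u"

definition sym_ext :: "('x \<Rightarrow> 'v) \<Rightarrow> ('x \<Rightarrow> 'x) \<Rightarrow> ('x \<Rightarrow> 'x) \<Rightarrow> 'x \<Rightarrow> 'v" where
  "sym_ext \<iota> star \<Theta> u = \<iota> (star (\<Theta> u))"


section \<open>Extended real-valued functionals\<close>

text \<open>Functionals with values in \<open>\<real> \<union> {+\<infinity>}\<close> are \<open>ereal\<close>-valued functions avoiding \<open>-\<infinity>\<close>.\<close>

definition proper_functional :: "('a \<Rightarrow> ereal) \<Rightarrow> bool" where
  "proper_functional f \<longleftrightarrow> (\<forall>u. f u \<noteq> -\<infinity>) \<and> (\<exists>u. f u \<noteq> \<infinity>)"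

definition lower_semicontinuous :: "('a::topological_space \<Rightarrow> ereal) \<Rightarrow> bool" where
  "lower_semicontinuous f \<longleftrightarrow> (\<forall>u. \<forall>a < f u. eventually (\<lambda>w. a < f w) (nhds u))"

definition bounded_from_below :: "('a \<Rightarrow> ereal) \<Rightarrow> bool" where
  "bounded_from_below f \<longleftrightarrow> (\<exists>b::real. \<forall>u. ereal b \<le> f u)"


section \<open>Weak slope\<close>

text \<open>
  The metric space is a subspace \<open>Y\<close> of the ambient metric type, so its open balls are
  \<open>ball y \<delta> \<inter> Y\<close>. The set below always contains \<open>0\<close> when \<open>y \<in> Y\<close>, hence the
  supremum lies in \<open>[0, +\<infinity>]\<close>.
\<close>

definition metric_weak_slope ::
    "'a::metric_space set \<Rightarrow> ('a \<Rightarrow> real) \<Rightarrow> 'a \<Rightarrow> ereal" where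
  "metric_weak_slope Y g y = Sup {ereal \<sigma> | \<sigma>. \<sigma> \<ge> 0 \<and>
     (\<exists>\<delta>>0. \<exists>\<H> :: 'a \<times> real \<Rightarrow> 'a.
        continuous_on ((ball y \<delta> \<inter> Y) \<times> {0..\<delta>}) \<H> \<and>
        (\<forall>\<eta> \<in> ball y \<delta> \<inter> Y. \<forall>t \<in> {0..\<delta>}.
           \<H> (\<eta>, t) \<in> Y \<and> dist (\<H> (\<eta>, t)) \<eta> \<le> t \<and> g (\<H> (\<eta>, t)) \<le> g \<eta> - \<sigma> * t))}"

text \<open>
  The metric of the product type \<open>'x \<times> real\<close> is the Euclidean combination
  \<open>sqrt (dist u v ^ 2 + dist \<lambda> \<mu> ^ 2)\<close>, as required for the epigraph.
\<close>

definition epi :: "('x \<Rightarrow> ereal) \<Rightarrow> ('x \<times> real) set" where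
  "epi f = {(u, l). f u \<le> ereal l}"

text \<open>
  The weak slope is defined only where \<open>f\<close> is finite; we assign it the value \<open>+\<infinity>\<close> elsewhere.
  As the slope \<open>s\<close> of the 1-Lipschitz function \<open>snd\<close> never exceeds 1, the last branch is
  the case \<open>s = 1\<close>.
\<close>

definition weak_slope :: "('x::real_normed_vector \<Rightarrow> ereal) \<Rightarrow> 'x \<Rightarrow> ereal" where
  "weak_slope f u =
     (if f u = \<infinity> then \<infinity>
      else let s = metric_weak_slope (epi f) snd (u, real_of_ereal (f u)) in
        if s < 1 then ereal (real_of_ereal s / sqrt (1 - (real_of_ereal s)\<^sup>2)) else \<infinity>)"


section \<open>Symmetric Palais-Smale notions\<close>

text \<open>The requirement \<open>f (u j) < \<infinity>\<close> says that the weak slope is defined along the sequence.\<close>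

definition SPS_sequence ::
    "('x::real_normed_vector \<Rightarrow> 'v::real_normed_vector) \<Rightarrow> ('x \<Rightarrow> 'x) \<Rightarrow> ('x \<Rightarrow> 'x) \<Rightarrow>
     ('x \<Rightarrow> ereal) \<Rightarrow> real \<Rightarrow> (nat \<Rightarrow> 'x) \<Rightarrow> bool" where
  "SPS_sequence \<iota> star \<Theta> f c u \<longleftrightarrow>
     (\<forall>j. f (u j) < \<infinity>) \<and>
     (\<lambda>j. weak_slope f (u j)) \<longlonglongrightarrow> 0 \<and>
     (\<lambda>j. f (u j)) \<longlonglongrightarrow> ereal c \<and>
     (\<lambda>j. norm (\<iota> (u j) - sym_ext \<iota> star \<Theta> (u j))) \<longlonglongrightarrow> 0"

definition SPS_condition ::
    "('x::real_normed_vector \<Rightarrow> 'v::real_normed_vector) \<Rightarrow> ('x \<Rightarrow> 'x) \<Rightarrow> ('x \<Rightarrow> 'x) \<Rightarrow>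
     ('x \<Rightarrow> ereal) \<Rightarrow> real \<Rightarrow> bool" where
  "SPS_condition \<iota> star \<Theta> f c \<longleftrightarrow>
     (\<forall>u. SPS_sequence \<iota> star \<Theta> f c u \<longrightarrow>
        (\<exists>r l. strict_mono (r :: nat \<Rightarrow> nat) \<and> (u \<circ> r) \<longlonglongrightarrow> l))"

end

theory Submission
  imports Defs
begin

text \<open>
  A point of \<open>S\<close> with nearly minimal energy may be polarized until it is \<open>V\<close>-close to its
  symmetrization, without increasing the energy and without changing the symmetrization. Ekeland's
  principle started from there yields a nearby \<open>v\<close> at which \<open>f\<close> decreases with speed at most
  \<open>\<epsilon>\<close>, which bounds the weak slope; and since \<open>u \<mapsto> u\<^sup>*\<close> is Lipschitz in the \<open>V\<close>-norm,
  \<open>v\<close> is almost symmetric as well. The symmetry and the minimality pass to the limit of a convergent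
  Palais-Smale sequence.
\<close>

section \<open>Lower semicontinuous functionals\<close>

lemma lower_semicontinuous_LIMSEQ_le:
  fixes f :: "'a::topological_space \<Rightarrow> ereal"
  assumes lsc: "lower_semicontinuous f" and u: "u \<longlonglongrightarrow> z" and fu: "(\<lambda>n. f (u n)) \<longlonglongrightarrow> c"
  shows "f z \<le> c"
proof (rule ccontr)
  assume "\<not> f z \<le> c"
  then obtain a where a: "c < a" "a < f z"
    using dense by (auto simp: not_le)
  then have "eventually (\<lambda>w. a < f w) (nhds z)"
    using lsc by (auto simp: lower_semicontinuous_def)
  then have "eventually (\<lambda>n. a < f (u n)) sequentially"
    using u by (auto simp: filterlim_iff)
  then have "a \<le> c"
    using fu by (intro tendsto_lowerbound) (auto elim: eventually_mono)
  with a show False by simp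
qed

text \<open>The complement is open: a real number strictly between \<open>g u\<close> and
  \<open>f u\<close> keeps separating \<open>g\<close> from \<open>f\<close> near \<open>u\<close>.
  With a downward cone as \<open>g\<close>, this makes the sets in Ekeland's principle
  closed.\<close>

lemma lower_semicontinuous_closed_sublevel:
  fixes f :: "'a::t2_space \<Rightarrow> ereal" and g :: "'a \<Rightarrow> real"
  assumes lsc: "lower_semicontinuous f" and g: "continuous_on UNIV g"
  shows "closed {w. f w \<le> ereal (g w)}"
proof -
  have "eventually (\<lambda>w. ereal (g w) < f w) (nhds u)" if u: "ereal (g u) < f u" for u
  proof -
    obtain a where a: "g u < a" "ereal a < f u"
      using ereal_dense2[OF u] by auto
    have "isCont g u"
      using g continuous_on_eq_continuous_at[OF open_UNIV] by blast
    then have "(g \<longlongrightarrow> g u) (nhds u)"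
      by (simp add: isCont_def tendsto_at_iff_tendsto_nhds)
    then have "eventually (\<lambda>w. g w < a) (nhds u)"
      using a(1) by (rule order_tendstoD)
    moreover have "eventually (\<lambda>w. ereal a < f w) (nhds u)"
      using lsc a by (auto simp: lower_semicontinuous_def)
    ultimately show ?thesis
      by eventually_elim (blast intro: less_trans[OF less_ereal.simps(1)[THEN iffD2]])
  qed
  then have "open {w. ereal (g w) < f w}"
    by (subst open_subopen) (simp add: eventually_nhds subset_iff Ball_def)
  then show ?thesis
    by (simp add: closed_def Compl_eq not_le)
qed

section \<open>Ekeland's variational principle\<close>

text \<open>\<open>T x\<close> collects the points reached from \<open>x\<close> by a drop of
  \<open>f\<close> of at least \<open>e\<close> times the distance. Choosing successive points that
  almost minimize \<open>f\<close> over the current set makes these closed sets nest and shrink, so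
  completeness leaves a single point \<open>v\<close>. Then \<open>T v\<close> contains only
  \<open>v\<close>, which is the strict inequality.\<close>

theorem ekeland:
  fixes f :: "'a::complete_space \<Rightarrow> ereal"
  assumes lsc: "lower_semicontinuous f" and bdd: "bounded_from_below f"
    and fin: "f u < \<infinity>" and e: "e > 0"
  obtains v where "f v + ereal (e * dist u v) \<le> f u" "\<And>w. w \<noteq> v \<Longrightarrow> f v < f w + ereal (e * dist v w)"
proof -
  obtain b where b: "\<And>w. ereal b \<le> f w"
    using bdd by (auto simp: bounded_from_below_def)
  \<comment> \<open>\<open>D\<close> is the effective domain. Outside it \<open>g\<close> has the
    default value 0, but membership of \<open>w\<close> in \<open>T x\<close> puts \<open>w\<close>
    into \<open>D\<close> whatever \<open>x\<close> is.\<close>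
  define D where "D = {x. f x < \<infinity>}"
  define g where "g x = real_of_ereal (f x)" for x
  have f_g: "f x = ereal (g x)" if "x \<in> D" for x
    using that b[of x] by (cases "f x") (auto simp: D_def g_def)
  define T where "T x = {w. f w \<le> ereal (g x - e * dist x w)}" for x
  have T_D: "T x \<subseteq> D" for x
    using le_less_trans by (fastforce simp: T_def D_def)
  have self: "x \<in> T x" if "x \<in> D" for x
    using that by (simp add: T_def f_g)
  have T_iff: "w \<in> T x \<longleftrightarrow> w \<in> D \<and> g w + e * dist x w \<le> g x" for w x
    using T_D[of x] f_g[of w] by (auto simp: T_def algebra_simps)
  \<comment> \<open>Transitivity of the order behind \<open>T\<close>, from the triangle
    inequality.\<close>
  have T_mono: "T y \<subseteq> T x" if "y \<in> T x" for x y
  proof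
    fix w assume w: "w \<in> T y"
    have "e * dist x w \<le> e * dist x y + e * dist y w"
      using e by (metis distrib_left dist_triangle mult_left_mono less_imp_le)
    with w that show "w \<in> T x" by (auto simp: T_iff)
  qed
  have closed_T: "closed (T x)" for x
    unfolding T_def by (intro lower_semicontinuous_closed_sublevel lsc continuous_intros)
  have g_ge: "b \<le> g x" if "x \<in> D" for x
    using b[of x] f_g[OF that] by simp
  have bdd_T: "bdd_below (g ` T x)" for x
    using g_ge T_D by (intro bdd_belowI[of _ b]) blast
  have step: "\<exists>y. y \<in> T x \<and> g y < Inf (g ` T x) + (1/2)^n" if "x \<in> D" for x and n :: nat
    using cInf_lessD[of "g ` T x" "Inf (g ` T x) + (1/2)^n"] self[OF that] by auto
  \<comment> \<open>The implication from \<open>n = 0\<close> is carried in the invariant because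
    dependent choice only asserts that some initial point exists, whereas the sequence must start at
    \<open>u\<close>.\<close>
  have "\<exists>x. \<forall>n. (x n \<in> D \<and> (n = 0 \<longrightarrow> x n = u)) \<and>
      (x (Suc n) \<in> T (x n) \<and> g (x (Suc n)) < Inf (g ` T (x n)) + (1/2)^n)"
  proof (rule dependent_nat_choice)
    show "\<exists>x. x \<in> D \<and> (0 = (0::nat) \<longrightarrow> x = u)"
      using fin by (auto simp: D_def)
    show "\<exists>y. (y \<in> D \<and> (Suc n = 0 \<longrightarrow> y = u)) \<and>
        (y \<in> T x \<and> g y < Inf (g ` T x) + (1/2)^n)"
      if "x \<in> D \<and> (n = 0 \<longrightarrow> x = u)" for x n
      using step[of x n] that T_D by blast
  qed
  then obtain x where x: "\<And>n. x n \<in> D" "x 0 = u" "\<And>n. x (Suc n) \<in> T (x n)"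
      "\<And>n. g (x (Suc n)) < Inf (g ` T (x n)) + (1/2)^n"
    by metis
  have dec: "T (x n) \<subseteq> T (x m)" if "m \<le> n" for m n
    using lift_Suc_antimono_le[of "\<lambda>n. T (x n)", OF T_mono[OF x(3)] that] .
  \<comment> \<open>Such a \<open>w\<close> also lies in \<open>T (x n)\<close>, so
    \<open>g w\<close> is at least the infimum there. Since \<open>x (Suc n)\<close> nearly attains
    that infimum, little drop is left to pay for the distance.\<close>
  have near: "e * dist (x (Suc n)) w < (1/2)^n" if "w \<in> T (x (Suc n))" for w n
  proof -
    have "w \<in> T (x n)"
      using that dec[of n "Suc n"] by auto
    then have "Inf (g ` T (x n)) \<le> g w"
      by (intro cInf_lower bdd_T) auto
    then show ?thesis
      using that x(4)[of n] by (auto simp: T_iff)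
  qed
  have small: "\<exists>n. \<forall>y\<in>T (x n). \<forall>z\<in>T (x n). dist y z < r" if "r > 0" for r
  proof -
    obtain n where n: "(1/2::real)^n < e * r / 2"
      using real_arch_pow_inv[of "e * r / 2" "1/2"] e \<open>r > 0\<close> by auto
    have "dist (x (Suc n)) y < r / 2" if "y \<in> T (x (Suc n))" for y
    proof -
      have "e * dist (x (Suc n)) y < e * (r / 2)"
        using near[OF that] n by simp
      then show ?thesis using e by (simp only: mult_less_cancel_left_pos)
    qed
    then show ?thesis
      by (meson dist_triangle_half_r)
  qed
  obtain v where v: "(\<Inter>n. T (x n)) = {v}"
    using decreasing_closed_nest_sing[of "\<lambda>n. T (x n)"] closed_T dec self x(1) small
    by (smt (verit) empty_iff range_eqI)
  have vT: "v \<in> T (x n)" for n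
    using v by auto
  have vD: "v \<in> D" using vT T_D by blast
  show thesis
  proof
    \<comment> \<open>This is \<open>v \<in> T (x 0)\<close>, as \<open>x 0\<close> is
      \<open>u\<close>.\<close>
    show "f v + ereal (e * dist u v) \<le> f u"
      using vT[of 0] x(1)[of 0] x(2) vD by (simp add: T_iff f_g)
    fix w assume "w \<noteq> v"
    have "w \<notin> T v"
    proof
      assume "w \<in> T v"
      then have "w \<in> (\<Inter>n. T (x n))"
        using T_mono[OF vT] by blast
      with v \<open>w \<noteq> v\<close> show False by auto
    qed
    then show "f v < f w + ereal (e * dist v w)"
    proof (cases "w \<in> D")
      case True
      with \<open>w \<notin> T v\<close> show ?thesis
        using f_g[OF True] f_g[OF vD] by (simp add: T_iff)
    next
      case False
      then show ?thesis
        using f_g[OF vD] by (simp add: D_def)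
    qed
  qed
qed

section \<open>Bounds for the weak slope\<close>

text \<open>The stationary deformation \<open>fst\<close> is admissible with rate 0.\<close>

lemma metric_weak_slope_nonneg: "0 \<le> metric_weak_slope Y g y"
proof -
  have "\<exists>\<delta>>0. \<exists>\<H>. continuous_on ((ball y \<delta> \<inter> Y) \<times> {0..\<delta>}) \<H> \<and>
      (\<forall>\<eta>\<in>ball y \<delta> \<inter> Y. \<forall>t\<in>{0..\<delta>}.
         \<H> (\<eta>, t) \<in> Y \<and> dist (\<H> (\<eta>, t)) \<eta> \<le> t \<and> g (\<H> (\<eta>, t)) \<le> g \<eta> - 0 * t)"
    by (intro exI[of _ "1::real"] exI[of _ fst] conjI continuous_on_fst continuous_on_id) auto
  then show ?thesis
    unfolding metric_weak_slope_def zero_ereal_def by (intro Sup_upper) blast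
qed

lemma weak_slope_nonneg: "0 \<le> weak_slope f u"
proof -
  let ?s = "metric_weak_slope (epi f) snd (u, real_of_ereal (f u))"
  have "0 \<le> real_of_ereal ?s / sqrt (1 - (real_of_ereal ?s)\<^sup>2)" if less: "?s < 1"
  proof -
    obtain s where s: "?s = ereal s" "0 \<le> s" "s < 1"
      using less metric_weak_slope_nonneg[of "epi f" snd "(u, real_of_ereal (f u))"]
      by (cases ?s) auto
    then have "s\<^sup>2 \<le> 1"
      by (simp add: power_le_one)
    with s show ?thesis by simp
  qed
  then show ?thesis
    by (simp add: weak_slope_def Let_def)
qed

text \<open>Follow \<open>(v, r)\<close> under a deformation up to time \<open>\<delta>\<close>, to
  a point \<open>(w, \<mu>)\<close> of the epigraph. The drop \<open>r - \<mu>\<close> is at least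
  \<open>\<sigma> * \<delta>\<close> and at most \<open>e * dist v w\<close>, while horizontal
  distance and drop together have Euclidean length at most \<open>\<delta>\<close>. Steepness
  \<open>e\<close> thus limits the rate to the sine of the angle with tangent
  \<open>e\<close>.\<close>

lemma epi_weak_slope_le:
  fixes f :: "'x::real_normed_vector \<Rightarrow> ereal"
  assumes fv: "f v = ereal r" and e: "e \<ge> 0"
    and slow: "\<And>w. f v \<le> f w + ereal (e * dist v w)"
  shows "metric_weak_slope (epi f) snd (v, r) \<le> ereal (e / sqrt (1 + e\<^sup>2))"
  unfolding metric_weak_slope_def
proof (rule Sup_least, safe)
  fix \<sigma> \<delta> :: real and \<H> :: "('x \<times> real) \<times> real \<Rightarrow> 'x \<times> real"
  assume \<sigma>: "0 \<le> \<sigma>" and \<delta>: "0 < \<delta>"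
    and \<H>: "\<forall>\<eta>\<in>ball (v, r) \<delta> \<inter> epi f. \<forall>t\<in>{0..\<delta>}.
      \<H> (\<eta>, t) \<in> epi f \<and> dist (\<H> (\<eta>, t)) \<eta> \<le> t \<and> snd (\<H> (\<eta>, t)) \<le> snd \<eta> - \<sigma> * t"
  obtain w \<mu> where w\<mu>: "\<H> ((v, r), \<delta>) = (w, \<mu>)"
    by fastforce
  have "(v, r) \<in> ball (v, r) \<delta> \<inter> epi f"
    using \<delta> fv by (simp add: epi_def)
  with \<H> have "\<forall>t\<in>{0..\<delta>}. \<H> ((v, r), t) \<in> epi f \<and> dist (\<H> ((v, r), t)) (v, r) \<le> t \<and>
      snd (\<H> ((v, r), t)) \<le> snd (v, r) - \<sigma> * t"
    by (rule bspec)
  from bspec[OF this, of \<delta>] \<delta> w\<mu> have fw: "f w \<le> ereal \<mu>" and d: "dist (w, \<mu>) (v, r) \<le> \<delta>" and \<mu>: "\<mu> \<le> r - \<sigma> * \<delta>"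
    by (simp_all add: epi_def)
  have "ereal r \<le> ereal \<mu> + ereal (e * dist v w)"
    using slow[of w] fw fv by (metis add_right_mono order_trans)
  then have "\<sigma> * \<delta> \<le> r - \<mu>" "r - \<mu> \<le> e * dist v w"
    using \<mu> by auto
  moreover have "0 \<le> \<sigma> * \<delta>"
    using \<sigma> \<delta> by simp
  ultimately have a: "(\<sigma> * \<delta>)\<^sup>2 \<le> (r - \<mu>)\<^sup>2" "(r - \<mu>)\<^sup>2 \<le> e\<^sup>2 * (dist v w)\<^sup>2"
    by (auto simp flip: power_mult_distrib intro!: power_mono)
  have "(dist v w)\<^sup>2 + (r - \<mu>)\<^sup>2 \<le> \<delta>\<^sup>2"
    using d by (auto simp: dist_prod_def dist_real_def dist_commute power2_commute dest: sqrt_le_D)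
  then have "e\<^sup>2 * ((dist v w)\<^sup>2 + (r - \<mu>)\<^sup>2) \<le> e\<^sup>2 * \<delta>\<^sup>2"
    by (intro mult_left_mono) auto
  \<comment> \<open>Adding \<open>e\<^sup>2 * (r - \<mu>)\<^sup>2\<close> to both sides of
    \<open>a(2)\<close> eliminates the horizontal distance.\<close>
  with a(2) have "(1 + e\<^sup>2) * (r - \<mu>)\<^sup>2 \<le> e\<^sup>2 * \<delta>\<^sup>2"
    by (simp add: algebra_simps)
  moreover have "(1 + e\<^sup>2) * (\<sigma> * \<delta>)\<^sup>2 \<le> (1 + e\<^sup>2) * (r - \<mu>)\<^sup>2"
    using a(1) by (intro mult_left_mono) auto
  ultimately have "\<sigma>\<^sup>2 * (1 + e\<^sup>2) * \<delta>\<^sup>2 \<le> e\<^sup>2 * \<delta>\<^sup>2"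
    by (simp add: power_mult_distrib mult_ac)
  then have "\<sigma>\<^sup>2 * (1 + e\<^sup>2) \<le> e\<^sup>2"
    using \<delta> by simp
  then have "(\<sigma> * sqrt (1 + e\<^sup>2))\<^sup>2 \<le> e\<^sup>2"
    by (simp add: power_mult_distrib)
  then have "\<sigma> * sqrt (1 + e\<^sup>2) \<le> e"
    using e by (rule power2_le_imp_le)
  then show "ereal \<sigma> \<le> ereal (e / sqrt (1 + e\<^sup>2))"
    by (simp add: pos_le_divide_eq add_pos_nonneg)
qed

text \<open>The map from \<open>s\<close> to \<open>s / sqrt (1 - s\<^sup>2)\<close> turns a sine
  into a tangent and is increasing on [0, 1), so it sends the previous bound
  \<open>e / sqrt (1 + e\<^sup>2)\<close> to \<open>e\<close>.\<close>

lemma weak_slope_le: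
  fixes f :: "'x::real_normed_vector \<Rightarrow> ereal"
  assumes fv: "f v = ereal r" and e: "e \<ge> 0"
    and slow: "\<And>w. f v \<le> f w + ereal (e * dist v w)"
  shows "weak_slope f v \<le> ereal e"
proof -
  let ?q = "sqrt (1 + e\<^sup>2)"
  have q: "?q > 0" "?q\<^sup>2 = 1 + e\<^sup>2"
    by (simp_all add: add_pos_nonneg)
  have "e < ?q"
    by (rule real_less_rsqrt) simp
  \<comment> \<open>This selects the finite branch in the definition of
    \<open>weak_slope\<close>.\<close>
  then have q1: "e / ?q < 1" using q by simp
  obtain s where s: "metric_weak_slope (epi f) snd (v, r) = ereal s" "0 \<le> s" "s \<le> e / ?q"
    using epi_weak_slope_le[OF assms] metric_weak_slope_nonneg[of "epi f" snd "(v, r)"]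
    by (cases "metric_weak_slope (epi f) snd (v, r)") auto
  have "s\<^sup>2 \<le> (e / ?q)\<^sup>2"
    using s by (intro power_mono) auto
  also have "(e / ?q)\<^sup>2 = 1 - (1 / ?q)\<^sup>2"
    using q by (simp add: power_divide field_simps)
  finally have "(1 / ?q)\<^sup>2 \<le> 1 - s\<^sup>2" by simp
  then have "1 / ?q \<le> sqrt (1 - s\<^sup>2)"
    by (rule real_le_rsqrt)
  then have "s / sqrt (1 - s\<^sup>2) \<le> (e / ?q) / (1 / ?q)"
    using s q e by (intro frac_le) auto
  then have "s / sqrt (1 - s\<^sup>2) \<le> e" using q by simp
  with s q1 fv show ?thesis
    by (simp add: weak_slope_def)
qed

section \<open>Iterated polarizations and almost symmetric points\<close>

context symmetrization_framework
begin

lemma iter_pol_maps: "u \<in> S \<Longrightarrow> set Hs \<subseteq> HH \<Longrightarrow> iter_pol pol u Hs \<in> S"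
  by (induction Hs arbitrary: u) (auto simp: iter_pol_def pol_maps)

lemma star_iter_pol: "u \<in> S \<Longrightarrow> set Hs \<subseteq> HH \<Longrightarrow> star (iter_pol pol u Hs) = star u"
  by (induction Hs arbitrary: u) (auto simp: iter_pol_def pol_maps star_pol)

lemma iter_pol_contraction:
  "u \<in> S \<Longrightarrow> v \<in> S \<Longrightarrow> set Hs \<subseteq> HH \<Longrightarrow>
    norm (\<iota> (iter_pol pol u Hs) - \<iota> (iter_pol pol v Hs)) \<le> norm (\<iota> u - \<iota> v)"
proof (induction Hs arbitrary: u v)
  case (Cons H Hs)
  have "norm (\<iota> (iter_pol pol (pol u H) Hs) - \<iota> (iter_pol pol (pol v H) Hs))
      \<le> norm (\<iota> (pol u H) - \<iota> (pol v H))"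
    using Cons.prems by (intro Cons.IH) (auto simp: pol_maps)
  also have "\<dots> \<le> norm (\<iota> u - \<iota> v)"
    using Cons.prems by (intro pol_contraction) auto
  finally show ?case by (simp add: iter_pol_def)
qed (simp add: iter_pol_def)

lemma iter_pol_decreasing:
  fixes f :: "'x \<Rightarrow> 'o::order"
  assumes "\<And>u H. u \<in> S \<Longrightarrow> H \<in> HH \<Longrightarrow> f (pol u H) \<le> f u"
  shows "u \<in> S \<Longrightarrow> set Hs \<subseteq> HH \<Longrightarrow> f (iter_pol pol u Hs) \<le> f u"
proof (induction Hs arbitrary: u)
  case (Cons H Hs)
  have "f (iter_pol pol (pol u H) Hs) \<le> f (pol u H)"
    using Cons.prems by (intro Cons.IH) (auto simp: pol_maps)
  also have "\<dots> \<le> f u"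
    using Cons.prems by (intro assms) auto
  finally show ?case by (simp add: iter_pol_def)
qed (simp add: iter_pol_def)

text \<open>The approximating sequence of polarizers is the same for all points of \<open>S\<close>,
  so the contraction estimate for finitely many polarizations passes to the limit.\<close>

lemma star_contraction:
  assumes "u \<in> S" "v \<in> S"
  shows "norm (\<iota> (star u) - \<iota> (star v)) \<le> norm (\<iota> u - \<iota> v)"
proof -
  obtain H :: "nat \<Rightarrow> 'h" where H: "range H \<subseteq> HH"
      "\<And>u. u \<in> S \<Longrightarrow> (\<lambda>m. \<iota> (iter_pol pol u (map H [1..<Suc m]))) \<longlonglongrightarrow> \<iota> (star u)"
    using approximation by blast
  have lim: "(\<lambda>m. norm (\<iota> (iter_pol pol u (map H [1..<Suc m])) - \<iota> (iter_pol pol v (map H [1..<Suc m]))))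
      \<longlonglongrightarrow> norm (\<iota> (star u) - \<iota> (star v))"
    by (intro tendsto_intros H assms)
  have "norm (\<iota> (iter_pol pol u (map H [1..<Suc m])) - \<iota> (iter_pol pol v (map H [1..<Suc m])))
      \<le> norm (\<iota> u - \<iota> v)" for m
    using H(1) by (intro iter_pol_contraction assms) auto
  then show ?thesis
    by (intro LIMSEQ_le_const2[OF lim]) blast
qed

lemma sym_ext_Lipschitz:
  obtains C where "C > 0"
    "\<And>u v. norm (sym_ext \<iota> star \<Theta> u - sym_ext \<iota> star \<Theta> v) \<le> C * norm (\<iota> u - \<iota> v)"
proof -
  obtain C where C: "C > 0" "\<And>u v. norm (\<iota> (\<Theta> u) - \<iota> (\<Theta> v)) \<le> C * norm (\<iota> u - \<iota> v)"
    using Theta_Lipschitz by blast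
  show thesis
    using C order_trans[OF star_contraction[OF Theta_maps Theta_maps] C(2)]
    by (intro that[of C]) (simp_all add: sym_ext_def)
qed

text \<open>Polarize \<open>u\<close> until it is V-close to \<open>star u\<close>. The polarized
  point has the same symmetrization and is fixed by \<open>\<Theta>\<close>, so it is close to its
  own symmetrization.\<close>

lemma ex_almost_symmetric:
  fixes f :: "'x \<Rightarrow> 'o::order"
  assumes "\<And>u H. u \<in> S \<Longrightarrow> H \<in> HH \<Longrightarrow> f (pol u H) \<le> f u"
    and u: "u \<in> S" and e: "e > 0"
  obtains w where "w \<in> S" "f w \<le> f u" "norm (\<iota> w - sym_ext \<iota> star \<Theta> w) < e"
proof -
  obtain H :: "nat \<Rightarrow> 'h" where H: "range H \<subseteq> HH"
      "(\<lambda>m. \<iota> (iter_pol pol u (map H [1..<Suc m]))) \<longlonglongrightarrow> \<iota> (star u)"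
    using approximation u by blast
  obtain m where m: "norm (\<iota> (iter_pol pol u (map H [1..<Suc m])) - \<iota> (star u)) < e"
    using LIMSEQ_D[OF H(2) e] by blast
  have Hs: "set (map H [1..<Suc m]) \<subseteq> HH"
    using H(1) by auto
  let ?w = "iter_pol pol u (map H [1..<Suc m])"
  show thesis
  proof
    show "?w \<in> S" by (rule iter_pol_maps[OF u Hs])
    then show "norm (\<iota> ?w - sym_ext \<iota> star \<Theta> ?w) < e"
      unfolding sym_ext_def using m star_iter_pol[OF u Hs] Theta_id by simp
    show "f ?w \<le> f u"
      using assms(1) u Hs by (rule iter_pol_decreasing)
  qed
qed

text \<open>Ekeland's principle starts at an almost symmetric \<open>\<eta>\<close> with energy
  below \<open>M + e\<^sup>2\<close>. The point \<open>v\<close> it yields stays close enough to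
  \<open>\<eta>\<close> to inherit the approximate symmetry.\<close>

lemma symmetric_ekeland:
  fixes f :: "'x \<Rightarrow> ereal"
  assumes f: "proper_functional f" "lower_semicontinuous f" "bounded_from_below f"
    and dec: "\<And>u H. u \<in> S \<Longrightarrow> H \<in> HH \<Longrightarrow> f (pol u H) \<le> f u"
    and S: "\<And>u. \<exists>\<xi>\<in>S. f \<xi> \<le> f u"
    and M: "ereal M = (INF u. f u)"
  obtains C where "C > 0" "\<And>e. e > 0 \<Longrightarrow> \<exists>v. norm (\<iota> v - sym_ext \<iota> star \<Theta> v) \<le> C * e \<and>
      f v < ereal (M + e\<^sup>2) \<and> (\<forall>w. f v \<le> f w + ereal (e * dist v w))"
proof -
  interpret bounded_linear \<iota> by (rule embedding_bounded_linear)
  obtain K where K: "K > 0" "\<And>x. norm (\<iota> x) \<le> norm x * K"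
    using pos_bounded by blast
  obtain L where L: "L > 0"
      "\<And>u v. norm (sym_ext \<iota> star \<Theta> u - sym_ext \<iota> star \<Theta> v) \<le> L * norm (\<iota> u - \<iota> v)"
    using sym_ext_Lipschitz by blast
  \<comment> \<open>Moving by at most \<open>e\<close> in X costs \<open>K * e\<close> in V and
    \<open>L * K * e\<close> for the symmetrizations; the summand 1 is the asymmetry of the starting
    point.\<close>
  define C where "C = (1 + L) * K + 1"
  have "\<exists>v. norm (\<iota> v - sym_ext \<iota> star \<Theta> v) \<le> C * e \<and>
      f v < ereal (M + e\<^sup>2) \<and> (\<forall>w. f v \<le> f w + ereal (e * dist v w))" if e: "e > 0" for e
  proof -
    have "(INF u. f u) < ereal (M + e\<^sup>2)"
      using M e by (simp flip: M)
    then obtain u where u: "u \<in> S" "f u < ereal (M + e\<^sup>2)"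
      using S by (metis INF_less_iff le_less_trans)
    obtain \<eta> where \<eta>: "f \<eta> \<le> f u" "norm (\<iota> \<eta> - sym_ext \<iota> star \<Theta> \<eta>) < e"
      using ex_almost_symmetric[OF dec u(1) e] by blast
    have f\<eta>: "f \<eta> < ereal (M + e\<^sup>2)"
      using \<eta>(1) u(2) by simp
    then have "f \<eta> < \<infinity>" by auto
    then obtain v where v: "f v + ereal (e * dist \<eta> v) \<le> f \<eta>"
        "\<And>w. w \<noteq> v \<Longrightarrow> f v < f w + ereal (e * dist v w)"
      using ekeland[OF f(2,3) _ e] by metis
    \<comment> \<open>As \<open>f v\<close> is at least \<open>M\<close> and the energy excess of
      \<open>\<eta>\<close> is below \<open>e\<^sup>2\<close>, a penalty of slope \<open>e\<close>
      allows a displacement of at most \<open>e\<close>.\<close>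
    have "ereal M + ereal (e * dist \<eta> v) \<le> f v + ereal (e * dist \<eta> v)"
      unfolding M by (intro add_right_mono INF_lower) simp
    also have "\<dots> < ereal (M + e\<^sup>2)"
      using v(1) f\<eta> by simp
    finally have "e * dist \<eta> v < e * e"
      by (simp add: power2_eq_square)
    then have "dist \<eta> v \<le> e" using e by simp
    then have "norm (v - \<eta>) * K \<le> e * K"
      using K(1) by (intro mult_right_mono) (auto simp: dist_norm norm_minus_commute)
    then have d: "norm (\<iota> v - \<iota> \<eta>) \<le> K * e"
      using K(2)[of "v - \<eta>"] by (simp add: diff mult.commute)
    have "norm (\<iota> v - sym_ext \<iota> star \<Theta> v) \<le> norm (\<iota> v - \<iota> \<eta>) +
        norm (\<iota> \<eta> - sym_ext \<iota> star \<Theta> \<eta>) + norm (sym_ext \<iota> star \<Theta> \<eta> - sym_ext \<iota> star \<Theta> v)"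
      by norm
    also have "\<dots> \<le> K * e + e + L * (K * e)"
      using d \<eta>(2) L(1) order_trans[OF L(2)[of \<eta> v] mult_left_mono, of "K * e"]
      by (intro add_mono) (auto simp: norm_minus_commute)
    also have "\<dots> = C * e"
      by (simp add: C_def algebra_simps)
    finally have "norm (\<iota> v - sym_ext \<iota> star \<Theta> v) \<le> C * e" .
    moreover have "f v \<le> f v + ereal (e * dist \<eta> v)"
      using e by (intro ereal_le_add_self) auto
    then have "f v < ereal (M + e\<^sup>2)"
      using v(1) f\<eta> by order
    moreover have "f v \<le> f w + ereal (e * dist v w)" for w
      using v(2)[of w] by (cases "w = v") auto
    ultimately show ?thesis by blast
  qed
  moreover have "C > 0" using K L by (simp add: C_def add_nonneg_pos)
  ultimately show thesis using that by blast
qed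

section \<open>Palais-Smale sequences and their limits\<close>

lemma sym_ext_LIMSEQ:
  assumes "u \<longlonglongrightarrow> z"
  shows "(\<lambda>n. \<iota> (u n)) \<longlonglongrightarrow> \<iota> z" "(\<lambda>n. sym_ext \<iota> star \<Theta> (u n)) \<longlonglongrightarrow> sym_ext \<iota> star \<Theta> z"
proof -
  show lim: "(\<lambda>n. \<iota> (u n)) \<longlonglongrightarrow> \<iota> z"
    using embedding_bounded_linear assms by (rule bounded_linear.tendsto)
  obtain L where L: "\<And>u v. norm (sym_ext \<iota> star \<Theta> u - sym_ext \<iota> star \<Theta> v) \<le> L * norm (\<iota> u - \<iota> v)"
    using sym_ext_Lipschitz by blast
  have "(\<lambda>n. L * norm (\<iota> (u n) - \<iota> z)) \<longlonglongrightarrow> L * norm (\<iota> z - \<iota> z)"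
    by (intro tendsto_intros lim)
  then have "(\<lambda>n. L * norm (\<iota> (u n) - \<iota> z)) \<longlonglongrightarrow> 0" by simp
  then have "(\<lambda>n. sym_ext \<iota> star \<Theta> (u n) - sym_ext \<iota> star \<Theta> z) \<longlonglongrightarrow> 0"
    by (rule Lim_null_comparison[rotated]) (simp add: L)
  then show "(\<lambda>n. sym_ext \<iota> star \<Theta> (u n)) \<longlonglongrightarrow> sym_ext \<iota> star \<Theta> z"
    by (simp add: LIM_zero_iff)
qed

text \<open>Lower semicontinuity makes \<open>z\<close> a minimizer. Its weak slope then vanishes by
  minimality, not by passing the slopes \<open>weak_slope f (u n)\<close> to the limit. Symmetry
  survives because \<open>\<iota>\<close> and the extended symmetrization are continuous along the
  sequence.\<close>

lemma SPS_sequence_limit: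
  assumes lsc: "lower_semicontinuous f" and M: "ereal M = (INF u. f u)"
    and sps: "SPS_sequence \<iota> star \<Theta> f M u"
    and r: "strict_mono r" and lim: "(u \<circ> r) \<longlonglongrightarrow> z"
  shows "weak_slope f z = 0" "f z = ereal M" "\<iota> z = sym_ext \<iota> star \<Theta> z"
proof -
  have sub: "((\<lambda>n. g (u n)) \<circ> r) \<longlonglongrightarrow> l" if "(\<lambda>n. g (u n)) \<longlonglongrightarrow> l"
    for g :: "'x \<Rightarrow> 'q::topological_space" and l
    using that r by (rule LIMSEQ_subseq_LIMSEQ)
  have M_le: "ereal M \<le> f w" for w
    unfolding M by (rule INF_lower) simp
  have "(\<lambda>n. f ((u \<circ> r) n)) \<longlonglongrightarrow> ereal M"
    using sub[of f "ereal M"] sps by (simp add: SPS_sequence_def o_def)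
  then have "f z \<le> ereal M"
    using lower_semicontinuous_LIMSEQ_le[OF lsc lim] by blast
  with M_le show fz: "f z = ereal M" by (intro antisym)
  \<comment> \<open>At a global minimum the slow-decrease hypothesis holds with rate 0.\<close>
  have "weak_slope f z \<le> ereal 0"
    using fz M_le by (intro weak_slope_le) (auto simp flip: zero_ereal_def)
  then show "weak_slope f z = 0"
    using weak_slope_nonneg[of f z] by (simp flip: zero_ereal_def)
  have "(\<lambda>n. norm (\<iota> ((u \<circ> r) n) - sym_ext \<iota> star \<Theta> ((u \<circ> r) n)))
      \<longlonglongrightarrow> norm (\<iota> z - sym_ext \<iota> star \<Theta> z)"
    by (intro tendsto_intros sym_ext_LIMSEQ lim)
  moreover have "(\<lambda>n. norm (\<iota> ((u \<circ> r) n) - sym_ext \<iota> star \<Theta> ((u \<circ> r) n))) \<longlonglongrightarrow> 0"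
    using sub[of "\<lambda>u. norm (\<iota> u - sym_ext \<iota> star \<Theta> u)" 0] sps by (simp add: SPS_sequence_def o_def)
  ultimately show "\<iota> z = sym_ext \<iota> star \<Theta> z"
    using LIMSEQ_unique by fastforce
qed

end

text \<open>Apply the existence property with a positive null sequence of parameters; asymmetry,
  energy and slope are each squeezed to their limits.\<close>

lemma SPS_sequenceI:
  assumes M: "ereal M = (INF u. f u)"
    and P: "\<And>e. e > 0 \<Longrightarrow> \<exists>v. norm (\<iota> v - sym_ext \<iota> star \<Theta> v) \<le> C * e \<and>
      f v < ereal (M + e\<^sup>2) \<and> weak_slope f v \<le> ereal e"
  obtains u where "SPS_sequence \<iota> star \<Theta> f M u"
proof -
  define e where "e n = 1 / real (Suc n)" for n
  have e: "e n > 0" "e \<longlonglongrightarrow> 0" for n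
    unfolding e_def using lim_1_over_n LIMSEQ_Suc by fastforce+
  obtain u where u: "\<And>n. norm (\<iota> (u n) - sym_ext \<iota> star \<Theta> (u n)) \<le> C * e n"
      "\<And>n. f (u n) < ereal (M + (e n)\<^sup>2)" "\<And>n. weak_slope f (u n) \<le> ereal (e n)"
    using P[OF e(1)] by metis
  have "(\<lambda>n. C * e n) \<longlonglongrightarrow> C * 0"
    by (intro tendsto_intros e)
  then have "(\<lambda>n. C * e n) \<longlonglongrightarrow> 0" by simp
  then have sym: "(\<lambda>n. norm (\<iota> (u n) - sym_ext \<iota> star \<Theta> (u n))) \<longlonglongrightarrow> 0"
    by (rule tendsto_sandwich[OF _ _ tendsto_const, rotated 2]) (simp_all add: u)
  have "(\<lambda>n. ereal (e n)) \<longlonglongrightarrow> ereal 0"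
    using e(2) by (rule tendsto_ereal)
  then have slope: "(\<lambda>n. weak_slope f (u n)) \<longlonglongrightarrow> 0"
    by (intro tendsto_sandwich[OF _ _ tendsto_const[of 0], of "\<lambda>n. weak_slope f (u n)" _ "\<lambda>n. ereal (e n)"])
      (auto simp: u weak_slope_nonneg zero_ereal_def[symmetric])
  have "(\<lambda>n. ereal (M + (e n)\<^sup>2)) \<longlonglongrightarrow> ereal (M + 0\<^sup>2)"
    by (intro tendsto_intros e)
  then have "(\<lambda>n. ereal (M + (e n)\<^sup>2)) \<longlonglongrightarrow> ereal M" by simp
  moreover have "ereal M \<le> f w" for w
    unfolding M by (rule INF_lower) simp
  ultimately have "(\<lambda>n. f (u n)) \<longlonglongrightarrow> ereal M"
    by (intro tendsto_sandwich[OF _ _ tendsto_const[of "ereal M"], of "\<lambda>n. f (u n)" _ "\<lambda>n. ereal (M + (e n)\<^sup>2)"])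
      (auto intro!: always_eventually less_imp_le u)
  moreover have "f (u n) < \<infinity>" for n
    using u(2)[of n] by auto
  ultimately have "SPS_sequence \<iota> star \<Theta> f M u"
    using sym slope by (simp add: SPS_sequence_def)
  then show thesis ..
qed

lemma proper_bounded_INF_real:
  assumes "proper_functional f" "bounded_from_below f"
  obtains M where "ereal M = (INF u. f u)"
proof -
  obtain u where "f u \<noteq> \<infinity>"
    using assms(1) by (auto simp: proper_functional_def)
  then have "(INF u. f u) \<noteq> \<infinity>"
    by (metis INF_lower UNIV_I ereal_infty_less_eq(1))
  moreover obtain b where "\<And>u. ereal b \<le> f u"
    using assms(2) by (auto simp: bounded_from_below_def)
  then have "ereal b \<le> (INF u. f u)"
    by (intro INF_greatest)
  ultimately show thesis
    using that by (cases "INF u. f u") auto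
qed

theorem corollary1p3:
  fixes \<iota> :: "'x::banach \<Rightarrow> 'v::banach"
    and S :: "'x set"
    and HH :: "'h::topological_space set"
    and star :: "'x \<Rightarrow> 'x"
    and pol :: "'x \<Rightarrow> 'h \<Rightarrow> 'x"
    and \<Theta> :: "'x \<Rightarrow> 'x"
    and f :: "'x \<Rightarrow> ereal"
  assumes "symmetrization_framework \<iota> S HH star pol \<Theta>"
    and "proper_functional f"
    and "lower_semicontinuous f"
    and "bounded_from_below f"
    and "\<And>u H. u \<in> S \<Longrightarrow> H \<in> HH \<Longrightarrow> f (pol u H) \<le> f u"
    and "\<And>u. \<exists>\<xi>\<in>S. f \<xi> \<le> f u"
  shows "\<exists>M::real. ereal M = (INF u. f u) \<and>
    (\<exists>C::real. C > 0 \<and> (\<forall>\<epsilon>::real. \<epsilon> > 0 \<longrightarrow>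
       (\<exists>v. norm (\<iota> v - sym_ext \<iota> star \<Theta> v) \<le> C * \<epsilon> \<and>
            f v < ereal (M + \<epsilon>\<^sup>2) \<and>
            weak_slope f v \<le> ereal \<epsilon>))) \<and>
    (\<exists>u. SPS_sequence \<iota> star \<Theta> f M u) \<and>
    (SPS_condition \<iota> star \<Theta> f M \<longrightarrow>
       (\<exists>z. weak_slope f z = 0 \<and> f z = ereal M \<and> \<iota> z = sym_ext \<iota> star \<Theta> z))"
proof -
  interpret symmetrization_framework \<iota> S HH star pol \<Theta> by (rule assms(1))
  obtain M where M: "ereal M = (INF u. f u)"
    using proper_bounded_INF_real[OF assms(2,4)] .
  have M_le: "ereal M \<le> f w" for w
    unfolding M by (rule INF_lower) simp
  obtain C where C: "C > 0" "\<And>\<epsilon>. \<epsilon> > 0 \<Longrightarrow> \<exists>v. norm (\<iota> v - sym_ext \<iota> star \<Theta> v) \<le> C * \<epsilon> \<and>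
      f v < ereal (M + \<epsilon>\<^sup>2) \<and> (\<forall>w. f v \<le> f w + ereal (\<epsilon> * dist v w))"
    using symmetric_ekeland[OF assms(2-6) M] by blast
  have slope: "weak_slope f v \<le> ereal \<epsilon>"
    if v: "f v < ereal (M + \<epsilon>\<^sup>2)" "\<forall>w. f v \<le> f w + ereal (\<epsilon> * dist v w)" "\<epsilon> > 0" for v \<epsilon>
  proof -
    \<comment> \<open>The energy bound excludes the value plus infinity, and the lower bound
      \<open>M\<close> excludes minus infinity.\<close>
    obtain r where "f v = ereal r"
      using v(1) M_le[of v] by (cases "f v") auto
    then show ?thesis
      using v by (intro weak_slope_le) auto
  qed
  have abc: "\<exists>v. norm (\<iota> v - sym_ext \<iota> star \<Theta> v) \<le> C * \<epsilon> \<and>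
      f v < ereal (M + \<epsilon>\<^sup>2) \<and> weak_slope f v \<le> ereal \<epsilon>" if "\<epsilon> > 0" for \<epsilon>
    using C(2)[OF that] slope that by blast
  obtain u where u: "SPS_sequence \<iota> star \<Theta> f M u"
    using SPS_sequenceI[OF M abc] by blast
  have "\<exists>z. weak_slope f z = 0 \<and> f z = ereal M \<and> \<iota> z = sym_ext \<iota> star \<Theta> z"
    if sps: "SPS_condition \<iota> star \<Theta> f M"
  proof -
    obtain r z where "strict_mono r" "(u \<circ> r) \<longlonglongrightarrow> z"
      using sps u unfolding SPS_condition_def by blast
    then show ?thesis
      using SPS_sequence_limit[OF assms(3) M u] by blast
  qed
  then show ?thesis
    using M C(1) abc u by blast
qed

end
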